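(* Let $(X,\|\cdot\|)$ be a real normed space, let $n\ge2$, let $v_1,\ldots,v_n\in X$ be distinct vectors, and let $\psi\in\mathbf{\Psi}_n$. Let $|||\cdot|||_\psi$ be the norm on $X^n$ generated by $\psi$, and let $f_\psi(u):=|||(u-v_1,\ldots,u-v_n)|||_\psi$ for $u\in X$. Then: (i) $f_\psi(u)\to\infty$ as $\|u\|\to\infty$; (ii) $|||(u,\ldots,u)|||_\psi=n\,\psi\left(\frac1n,\ldots,\frac1n\right)\|u\|$ for all $u\in X$; (iii) if $\psi$ and $\|\cdot\|$ are strictly convex, then $f_\psi$ is strictly convex; (iv) if $\|\cdot\|$ is strictly convex, $v_1,\ldots,v_n$ are not collinear, and $\psi=\psi_1$ is the constant function $1$ on $\Omega_n$, then $f_\psi$ is strictly convex; (v) if $\dim X<\infty$, then the set of all global minimizers of $f_\psi$ over $X$ is compact.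
   Context: $\Omega_n:=\{(t_1,\ldots,t_n)\in\mathbb{R}^n_+\mid\sum_{i=1}^n t_i=1\}$. $\mathbf{\Psi}_n$ is the class of all convex continuous functions $\psi:\Omega_n\to\mathbb{R}$ such that $\psi(\mathbf e_1)=\cdots=\psi(\mathbf e_n)=1$, where $\mathbf e_1,\ldots,\mathbf e_n$ is the standard basis of $\mathbb{R}^n$, and $$\psi(t_1,\ldots,t_n)\ge(1-t_i)\,\psi\Big(\tfrac{t_1}{1-t_i},\ldots,\tfrac{t_{i-1}}{1-t_i},0,\tfrac{t_{i+1}}{1-t_i},\ldots,\tfrac{t_n}{1-t_i}\Big)$$ for all $(t_1,\ldots,t_n)\in\Omega_n$ and all $i\in\{1,\ldots,n\}$ with $t_i<1$. For $\psi\in\mathbf\Psi_n$, the norm $|||\cdot|||_\psi$ on $X^n$ is given by $|||0|||_\psi:=0$ and, for $x=(x_1,\ldots,x_n)\neq0$ and $S:=\sum_{i=1}^n\|x_i\|$, by $|||x|||_\psi:=S\cdot\psi\big(\|x_1\|/S,\ldots,\|x_n\|/S\big)$ (it is known that this is a norm). A convex function $g$ is strictly convex if $g(\lambda x+(1-\lambda)y)<\lambda g(x)+(1-\lambda)g(y)$ for all distinct $x,y$ in its domain and $\lambda\in(0,1)$. A norm $\|\cdot\|$ is strictly convex if $\|x+y\|<\|x\|+\|y\|$ for all nonzero $x,y\in X$ such that $x\ne\alpha y$ for all $\alpha>0$. Vectors $v_1,\ldots,v_n$ are collinear if they all lie on one affine line $\{ta+(1-t)b\mid t\in\mathbb{R}\}$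 with $a\ne b$. *)

theory Defs
  imports "HOL-Analysis.Analysis"
begin

text \<open>The index set \<open>{1, \<dots>, n}\<close> is a finite type \<open>'n\<close> with \<open>n = CARD('n)\<close>; the
  coordinates of \<open>t :: real ^ 'n\<close> are \<open>t $ i\<close>, and \<open>X\<^sup>n\<close> is \<open>'a ^ 'n\<close>.\<close>

definition Omega :: "(real ^ 'n) set" where
  "Omega = {t. (\<forall>i. 0 \<le> t $ i) \<and> (\<Sum>i\<in>UNIV. t $ i) = 1}"

text \<open>Members of \<open>Psi\<close> are functions on all of \<open>\<real>\<^sup>n\<close>, but only their values on \<open>Omega\<close>
  are constrained or used.\<close>

definition Psi :: "(real ^ 'n \<Rightarrow> real) set" where
  "Psi = {\<psi>. convex_on Omega \<psi> \<and> continuous_on Omega \<psi> \<and>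
     (\<forall>i. \<psi> (axis i 1) = 1) \<and>
     (\<forall>t\<in>Omega. \<forall>i. t $ i < 1 \<longrightarrow>
        \<psi> t \<ge> (1 - t $ i) * \<psi> (\<chi> j. if j = i then 0 else t $ j / (1 - t $ i)))}"

definition psi_norm :: "(real ^ 'n \<Rightarrow> real) \<Rightarrow> 'a::real_normed_vector ^ 'n \<Rightarrow> real" where
  "psi_norm \<psi> x =
     (if x = 0 then 0
      else let S = (\<Sum>i\<in>UNIV. norm (x $ i)) in S * \<psi> (\<chi> i. norm (x $ i) / S))"

definition f_psi ::
  "(real ^ 'n \<Rightarrow> real) \<Rightarrow> 'a::real_normed_vector ^ 'n \<Rightarrow> 'a \<Rightarrow> real" where
  "f_psi \<psi> v u = psi_norm \<psi> (\<chi> i. u - v $ i)"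

definition strictly_convex_on :: "'b::real_vector set \<Rightarrow> ('b \<Rightarrow> real) \<Rightarrow> bool" where
  "strictly_convex_on D g \<longleftrightarrow> convex_on D g \<and>
     (\<forall>x\<in>D. \<forall>y\<in>D. \<forall>l. x \<noteq> y \<and> 0 < l \<and> l < 1 \<longrightarrow>
        g (l *\<^sub>R x + (1 - l) *\<^sub>R y) < l * g x + (1 - l) * g y)"

text \<open>This differs from strict convexity as a function: no norm is a strictly convex function,
  except on the zero space.\<close>

definition strictly_convex_norm :: "('b::real_vector \<Rightarrow> real) \<Rightarrow> bool" where
  "strictly_convex_norm N \<longleftrightarrow>
     (\<forall>x y. x \<noteq> 0 \<and> y \<noteq> 0 \<and> (\<forall>\<alpha>>0. x \<noteq> \<alpha> *\<^sub>R y) \<longrightarrow> N (x + y) < N x + N y)"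

text \<open>The library's \<open>collinear\<close> is phrased with a common direction vector, which may be \<open>0\<close>;
  in a nonzero space it says that the set lies on a genuine affine line.\<close>

lemma collinear_iff_affine_line:
  fixes A :: "'b::real_vector set"
  assumes "\<exists>w::'b. w \<noteq> 0"
  shows "collinear A \<longleftrightarrow> (\<exists>a b. a \<noteq> b \<and> A \<subseteq> {t *\<^sub>R a + (1 - t) *\<^sub>R b | t. True})"
proof
  assume "collinear A"
  then obtain u where u: "\<And>x y. x \<in> A \<Longrightarrow> y \<in> A \<Longrightarrow> \<exists>c. x - y = c *\<^sub>R u"
    unfolding collinear_def by blast
  obtain w :: 'b where w: "w \<noteq> 0" using assms by blast
  obtain d where d: "d \<noteq> 0" "\<And>x y. x \<in> A \<Longrightarrow> y \<in> A \<Longrightarrow> \<exists>c. x - y = c *\<^sub>R d"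
  proof (cases "u = 0")
    case True
    have "\<exists>c. x - y = c *\<^sub>R w" if "x \<in> A" "y \<in> A" for x y
      using u[OF that] True by (intro exI[of _ 0]) auto
    with w that show ?thesis by blast
  next
    case False
    with u that show ?thesis by blast
  qed
  obtain p where p: "A = {} \<or> p \<in> A" by blast
  have "x \<in> {t *\<^sub>R (p + d) + (1 - t) *\<^sub>R p | t. True}" if "x \<in> A" for x
  proof -
    from that p have "p \<in> A" by blast
    from d(2)[OF that this] obtain c where "x - p = c *\<^sub>R d" by blast
    then have "x = c *\<^sub>R (p + d) + (1 - c) *\<^sub>R p"
      by (simp add: algebra_simps)
    then show ?thesis by blast
  qed
  moreover have "p + d \<noteq> p" using d(1) by simp
  ultimately show "\<exists>a b. a \<noteq> b \<and> A \<subseteq> {t *\<^sub>R a + (1 - t) *\<^sub>R b | t. True}"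
    by (intro exI[of _ "p + d"] exI[of _ p]) blast
next
  assume "\<exists>a b. a \<noteq> b \<and> A \<subseteq> {t *\<^sub>R a + (1 - t) *\<^sub>R b | t. True}"
  then obtain a b where ab: "A \<subseteq> {t *\<^sub>R a + (1 - t) *\<^sub>R b | t. True}" by blast
  have "\<exists>c. x - y = c *\<^sub>R (a - b)" if xy: "x \<in> A" "y \<in> A" for x y
  proof -
    obtain s where s: "x = s *\<^sub>R a + (1 - s) *\<^sub>R b" using ab xy(1) by blast
    obtain t where t: "y = t *\<^sub>R a + (1 - t) *\<^sub>R b" using ab xy(2) by blast
    have "x - y = (s - t) *\<^sub>R (a - b)" unfolding s t by (simp add: algebra_simps)
    then show ?thesis by blast
  qed
  then show "collinear A" unfolding collinear_def by blast
qed

end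

theory Submission
  imports Defs
begin

text \<open>For \<open>\<psi> \<in> Psi\<close>, the restriction of \<open>psi_norm \<psi>\<close> to the nonnegative orthant of \<open>\<real>\<^sup>n\<close> is the
  positively homogeneous extension of \<open>\<psi>\<close>. Convexity of \<open>\<psi>\<close> makes it subadditive there, and the
  inequality in the definition of \<open>Psi\<close> says that it does not increase when a coordinate is
  replaced by \<open>0\<close>. A vector with one coordinate decreased is a convex combination of the old vector
  and the one with that coordinate deleted, so the extension is monotone. If \<open>\<psi>\<close> is strictly
  convex, subadditivity is strict off common rays, and comparing \<open>x \<le> y\<close> with their midpoint makes
  monotonicity strict.

  Part (iii): equality in the convexity inequality for \<open>f_psi\<close> at \<open>x \<noteq> y\<close> forces the vectors of
  distances of \<open>x\<close> and \<open>y\<close> to the \<open>v\<^sub>i\<close> to be proportional with some factor \<open>k\<close>, and then strict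
  convexity of the norm gives \<open>x - v\<^sub>i = k (y - v\<^sub>i)\<close> for all \<open>i\<close>; two distinct \<open>v\<^sub>i\<close> yield
  \<open>k = 1\<close>. Part (iv): some \<open>v\<^sub>i\<close> lies off the line through \<open>x\<close> and \<open>y\<close>. Part (v): \<open>f_psi\<close> is
  Lipschitz and coercive.\<close>

section \<open>Compactness in finite-dimensional normed spaces\<close>

text \<open>Convergent sequences are bounded, so \<open>span B\<close> is closed and
  \<open>b\<close> has a positive distance \<delta> from it. This bounds the coefficient of
  \<open>b\<close>, and the new ball lies in a continuous image of a product of compact
  sets.\<close>

lemma compact_cball_Int_span_insert:
  fixes b :: "'a::real_normed_vector"
  assumes cpt: "\<And>R. compact (cball 0 R \<inter> span B)" and "b \<notin> span B"
  shows "compact (cball 0 R \<inter> span (insert b B))"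
proof -
  have "closed (span B)"
    unfolding closed_sequential_limits
  proof (intro allI impI, elim conjE)
    fix X l assume X: "\<forall>n. X n \<in> span B" and lim: "X \<longlonglongrightarrow> l"
    then have "bounded (range X)"
      by (intro convergent_imp_bounded)
    then obtain M where "\<And>n. norm (X n) \<le> M"
      unfolding bounded_iff by auto
    with X have "\<forall>n. X n \<in> cball 0 M \<inter> span B"
      by simp
    with lim compact_imp_closed[OF cpt[of M]] show "l \<in> span B"
      unfolding closed_sequential_limits by blast
  qed
  then obtain \<delta> where "\<delta> > 0" "ball b \<delta> \<subseteq> - span B"
    using \<open>b \<notin> span B\<close> open_contains_ball[of "- span B"] by (auto simp: open_Compl)
  then have \<delta>: "\<delta> > 0" "\<And>s. s \<in> span B \<Longrightarrow> dist b s \<ge> \<delta>"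
    by (auto simp: subset_iff) (meson not_less)
  \<comment> \<open>Factoring out \<open>t\<close> turns the norm into \<open>\<bar>t\<bar>\<close>
    times the distance from \<open>b\<close> to a point of \<open>span B\<close>.\<close>
  have coeff: "\<bar>t\<bar> * \<delta> \<le> norm (s + t *\<^sub>R b)" if "s \<in> span B" for s t
  proof (cases "t = 0")
    case False
    have "s + t *\<^sub>R b = t *\<^sub>R (b - (- (1 / t)) *\<^sub>R s)"
      using False by (simp add: algebra_simps)
    then have "norm (s + t *\<^sub>R b) = \<bar>t\<bar> * dist b ((- (1 / t)) *\<^sub>R s)"
      by (simp add: dist_norm)
    moreover have "(- (1 / t)) *\<^sub>R s \<in> span B"
      using that by (rule span_scale)
    ultimately show ?thesis
      using \<delta>(2) by (simp add: mult_left_mono)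
  qed simp
  \<comment> \<open>By \<open>coeff\<close>, \<open>M\<close> bounds the coefficient of
    \<open>b\<close>; the radius in \<open>A\<close> then bounds the remaining part by the triangle
    inequality. \<open>A\<close> may stick out of the ball, hence the intersection below.\<close>
  define M where "M = R / \<delta>"
  define A where "A = (\<lambda>(s, t). s + t *\<^sub>R b) ` ((cball 0 (R + M * norm b) \<inter> span B) \<times> {-M..M})"
  have "compact A"
    unfolding A_def
    by (intro compact_continuous_image compact_Times cpt compact_Icc)
      (auto simp: case_prod_unfold intro!: continuous_intros)
  moreover have "cball 0 R \<inter> span (insert b B) = cball 0 R \<inter> A"
  proof (intro equalityI subsetI)
    fix x assume x: "x \<in> cball 0 R \<inter> span (insert b B)"
    then obtain t where t: "x - t *\<^sub>R b \<in> span B"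
      by (auto simp: span_insert)
    define s where "s = x - t *\<^sub>R b"
    have xs: "x = s + t *\<^sub>R b" by (simp add: s_def)
    have "\<bar>t\<bar> * \<delta> \<le> R"
      using order_trans[OF coeff[of s t]] t x by (simp add: s_def)
    then have tM: "\<bar>t\<bar> \<le> M"
      using \<delta>(1) by (simp add: M_def field_simps)
    have "norm s \<le> norm x + \<bar>t\<bar> * norm b"
      using norm_triangle_ineq4[of x "t *\<^sub>R b"] by (simp add: s_def)
    also have "\<dots> \<le> R + M * norm b"
      using x tM by (intro add_mono mult_right_mono) auto
    finally have "(s, t) \<in> (cball 0 (R + M * norm b) \<inter> span B) \<times> {-M..M}"
      using t tM by (auto simp: s_def)
    then show "x \<in> cball 0 R \<inter> A"
      using x unfolding A_def xs by force
  next
    fix x assume "x \<in> cball 0 R \<inter> A"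
    then obtain s t where "norm x \<le> R" "s \<in> span B" "x = s + t *\<^sub>R b"
      unfolding A_def by auto
    moreover have "s \<in> span (insert b B)"
      using \<open>s \<in> span B\<close> span_mono[of B "insert b B"] by blast
    ultimately show "x \<in> cball 0 R \<inter> span (insert b B)"
      by (auto intro: span_add span_scale span_base)
  qed
  ultimately show ?thesis
    by (simp add: closed_Int_compact)
qed

lemma compact_cball_Int_span:
  fixes B :: "'a::real_normed_vector set"
  assumes "finite B"
  shows "compact (cball 0 R \<inter> span B)"
  using assms
proof (induction B arbitrary: R)
  case empty
  \<comment> \<open>\<open>R\<close> may be negative, so the intersection is only contained in
    \<open>{0}\<close>.\<close>
  have "cball 0 R \<inter> {0} \<subseteq> {0::'a}" by simp
  then show ?case
    by (simp add: finite_imp_compact)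
next
  case (insert b B)
  show ?case
  proof (cases "b \<in> span B")
    case True
    then show ?thesis
      using insert.IH by (simp add: span_redundant)
  next
    case False
    then show ?thesis
      using insert.IH by (intro compact_cball_Int_span_insert)
  qed
qed

text \<open>Finite dimension enters as a finite spanning set of the whole type; a bounded set lies
  in one of the compact balls above.\<close>

lemma finite_span_heine_borel:
  fixes S B :: "'a::real_normed_vector set"
  assumes "finite B" "span B = UNIV" "closed S" "bounded S"
  shows "compact S"
proof -
  obtain R where "S \<subseteq> cball 0 R"
    using \<open>bounded S\<close> by (auto simp: bounded_iff subset_iff)
  then have "S = S \<inter> (cball 0 R \<inter> span B)"
    using assms(2) by auto
  with assms(1,3) show ?thesis
    using closed_Int_compact[OF _ compact_cball_Int_span] by metis
qed

section \<open>The homogeneous extension on the nonnegative orthant\<close>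

lemma Psi_convex: "\<psi> \<in> Psi \<Longrightarrow> convex_on Omega \<psi>"
  by (simp add: Psi_def)

text \<open>Polar coordinates on the orthant: \<open>s\<close> is the coordinate sum of
  \<open>s *\<^sub>R t\<close>, so normalising returns \<open>t\<close>. With the next lemma, claims
  about the extension reduce to values of \<psi> on the simplex.\<close>

lemma psi_norm_scaleR_Omega:
  fixes t :: "real ^ 'n"
  assumes "t \<in> Omega" "0 \<le> s"
  shows "psi_norm \<psi> (s *\<^sub>R t) = s * \<psi> t"
proof (cases "s = 0")
  case False
  have S: "(\<Sum>i\<in>UNIV. norm ((s *\<^sub>R t) $ i)) = s"
    using assms by (simp add: Omega_def abs_mult flip: sum_distrib_left)
  moreover have "(\<chi> i. norm ((s *\<^sub>R t) $ i) / s) = t"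
    using assms False by (simp add: vec_eq_iff Omega_def abs_mult)
  moreover have "s *\<^sub>R t \<noteq> 0"
    using S False by auto
  ultimately show ?thesis
    by (simp only: psi_norm_def Let_def if_False)
qed (simp add: psi_norm_def)

lemma nonneg_vec_cases:
  fixes x :: "real ^ 'n"
  assumes "0 \<le> x"
  obtains "x = 0" | s t where "0 < s" "t \<in> Omega" "x = s *\<^sub>R t"
proof (cases "x = 0")
  case False
  have nn: "0 \<le> x $ i" for i
    using assms by (simp add: less_eq_vec_def)
  define s where "s = (\<Sum>i\<in>UNIV. x $ i)"
  have "s \<noteq> 0"
    using False nn by (auto simp: s_def sum_nonneg_eq_0_iff vec_eq_iff)
  with nn have s: "s > 0"
    by (simp add: s_def sum_nonneg less_le)
  have "(1 / s) *\<^sub>R x \<in> Omega"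
    using nn s by (simp add: Omega_def s_def flip: sum_divide_distrib)
  with s that(2)[of s "(1 / s) *\<^sub>R x"] show ?thesis
    by simp
qed (use that in blast)

lemma psi_norm_norm:
  "psi_norm \<psi> (\<chi> i. norm (x $ i)) = psi_norm \<psi> x"
  by (simp add: psi_norm_def vec_eq_iff)

lemma psi_norm_scaleR:
  fixes x :: "real ^ 'n"
  assumes "0 \<le> x" "0 \<le> c"
  shows "psi_norm \<psi> (c *\<^sub>R x) = c * psi_norm \<psi> x"
  using assms(1)
proof (cases rule: nonneg_vec_cases)
  case (2 s t)
  then show ?thesis
    using assms(2) psi_norm_scaleR_Omega[of t "c * s" \<psi>] psi_norm_scaleR_Omega[of t s \<psi>]
    by simp
qed (simp add: psi_norm_def)

text \<open>If \<open>x\<close> and \<open>y\<close> are \<open>s\<close> and \<open>r\<close> times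
  simplex points, then \<open>x + y\<close> is \<open>s + r\<close> times their average with weights
  \<open>s / (s + r)\<close> and \<open>r / (s + r)\<close>, to which convexity applies.\<close>

lemma psi_norm_add_le:
  fixes x y :: "real ^ 'n"
  assumes conv: "convex_on Omega \<psi>" and "0 \<le> x" "0 \<le> y"
  shows "psi_norm \<psi> (x + y) \<le> psi_norm \<psi> x + psi_norm \<psi> y"
  using assms(2)
proof (cases rule: nonneg_vec_cases)
  case 1
  then show ?thesis by (simp add: psi_norm_def)
next
  case x: (2 s t)
  show ?thesis
    using assms(3)
  proof (cases rule: nonneg_vec_cases)
    case 1
    then show ?thesis by (simp add: psi_norm_def)
  next
    case y: (2 r q)
    define w where "w = (s / (s + r)) *\<^sub>R t + (r / (s + r)) *\<^sub>R q"
    have sum1: "s / (s + r) + r / (s + r) = 1"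
      using x y by (simp flip: add_divide_distrib)
    have "w \<in> Omega"
      unfolding w_def using convex_on_imp_convex[OF conv] x y sum1 by (intro convexD) auto
    moreover have "x + y = (s + r) *\<^sub>R w"
      using x y by (simp add: w_def scaleR_add_right)
    ultimately have "psi_norm \<psi> (x + y) = (s + r) * \<psi> w"
      using x y by (simp add: psi_norm_scaleR_Omega)
    also have "\<dots> \<le> (s + r) * (s / (s + r) * \<psi> t + r / (s + r) * \<psi> q)"
      unfolding w_def using conv x y sum1 unfolding convex_on_def
      by (intro mult_left_mono) (simp_all del: times_divide_eq_left)
    also have "\<dots> = s * \<psi> t + r * \<psi> q"
      using x y by (simp add: distrib_left)
    finally show ?thesis
      using x y by (simp add: psi_norm_scaleR_Omega)
  qed
qed

lemma psi_norm_add_less: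
  fixes x y :: "real ^ 'n"
  assumes sconv: "strictly_convex_on Omega \<psi>" and "0 \<le> x" "0 \<le> y" "x \<noteq> 0" "y \<noteq> 0"
    and nonprop: "\<And>k. 0 < k \<Longrightarrow> x \<noteq> k *\<^sub>R y"
  shows "psi_norm \<psi> (x + y) < psi_norm \<psi> x + psi_norm \<psi> y"
proof -
  obtain s t where x: "0 < s" "t \<in> Omega" "x = s *\<^sub>R t"
    using nonneg_vec_cases[OF assms(2)] \<open>x \<noteq> 0\<close> by metis
  obtain r q where y: "0 < r" "q \<in> Omega" "y = r *\<^sub>R q"
    using nonneg_vec_cases[OF assms(3)] \<open>y \<noteq> 0\<close> by metis
  \<comment> \<open>Equal simplex points would make \<open>x\<close> a positive multiple of
    \<open>y\<close>.\<close>
  have "t \<noteq> q"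
    using nonprop[of "s / r"] x y by auto
  define l where "l = s / (s + r)"
  have l: "0 < l" "l < 1" "1 - l = r / (s + r)"
    using x y by (auto simp: l_def field_simps)
  define w where "w = l *\<^sub>R t + (1 - l) *\<^sub>R q"
  have "convex (Omega :: (real ^ 'n) set)"
    using sconv convex_on_imp_convex unfolding strictly_convex_on_def by blast
  then have "w \<in> Omega"
    unfolding w_def using x y l by (intro convexD) auto
  moreover have "x + y = (s + r) *\<^sub>R w"
    unfolding w_def l(3) using x y by (simp add: l_def scaleR_add_right)
  ultimately have "psi_norm \<psi> (x + y) = (s + r) * \<psi> w"
    using x y by (simp add: psi_norm_scaleR_Omega)
  also have "\<dots> < (s + r) * (l * \<psi> t + (1 - l) * \<psi> q)"
    unfolding w_def using sconv x y l(1,2) \<open>t \<noteq> q\<close>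
    by (intro mult_strict_left_mono) (auto simp: strictly_convex_on_def)
  also have "\<dots> = s * \<psi> t + r * \<psi> q"
    unfolding l(3) using x y by (simp add: l_def distrib_left)
  finally show ?thesis
    using x y by (simp add: psi_norm_scaleR_Omega)
qed

section \<open>Monotonicity of the homogeneous extension\<close>

lemma axis_in_Omega: "axis i 1 \<in> Omega"
  by (simp add: Omega_def axis_def)

lemma psi_norm_axis:
  assumes "\<psi> \<in> Psi" "0 \<le> c"
  shows "psi_norm \<psi> (axis i c) = c"
proof -
  have "axis i c = c *\<^sub>R axis i (1::real)"
    by (simp add: axis_def vec_eq_iff)
  then show ?thesis
    using assms psi_norm_scaleR_Omega[OF axis_in_Omega, of c \<psi>] by (simp add: Psi_def)
qed

text \<open>The defining inequality of \<open>Psi\<close>, made homogeneous: the factor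
  \<open>1 - t $ i\<close> is the mass that survives the deletion.\<close>

lemma psi_norm_delete_le:
  fixes x :: "real ^ 'n"
  assumes "\<psi> \<in> Psi" "0 \<le> x"
  shows "psi_norm \<psi> (\<chi> j. if j = i then 0 else x $ j) \<le> psi_norm \<psi> x"
  using assms(2)
proof (cases rule: nonneg_vec_cases)
  case 1
  then have "(\<chi> j. if j = i then 0 else x $ j) = x"
    by (simp add: vec_eq_iff)
  then show ?thesis by simp
next
  case (2 s t)
  have nn: "0 \<le> t $ j" for j
    using 2 by (simp add: Omega_def)
  have split: "t $ i + (\<Sum>j\<in>UNIV - {i}. t $ j) = 1"
    using 2 sum.remove[of UNIV i "\<lambda>j. t $ j"] by (simp add: Omega_def)
  have rest_nn: "0 \<le> (\<Sum>j\<in>UNIV - {i}. t $ j)"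
    using nn by (simp add: sum_nonneg)
  show ?thesis
  proof (cases "t $ i < 1")
    case True
    define t' where "t' = (\<chi> j. if j = i then 0 else t $ j / (1 - t $ i))"
    have "(\<Sum>j\<in>UNIV. t' $ j) = (\<Sum>j\<in>UNIV - {i}. t $ j / (1 - t $ i))"
      by (simp add: t'_def sum.remove[of UNIV i])
    also have "\<dots> = 1"
      using split True by (simp flip: sum_divide_distrib)
    finally have t': "t' \<in> Omega"
      using nn True by (simp add: Omega_def t'_def)
    have "(\<chi> j. if j = i then 0 else x $ j) = (s * (1 - t $ i)) *\<^sub>R t'"
      using 2 True by (simp add: t'_def vec_eq_iff)
    then have "psi_norm \<psi> (\<chi> j. if j = i then 0 else x $ j) = s * ((1 - t $ i) * \<psi> t')"
      using t' 2 True by (simp add: psi_norm_scaleR_Omega)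
    also have "\<dots> \<le> s * \<psi> t"
      using assms(1) 2 True by (intro mult_left_mono) (auto simp: Psi_def t'_def)
    finally show ?thesis
      using 2 by (simp add: psi_norm_scaleR_Omega)
  next
    case False
    \<comment> \<open>Only the vertex \<open>axis i 1\<close> remains: deletion turns it into
      \<open>0\<close>, and the extension at \<open>x\<close> is \<open>s\<close>.\<close>
    then have zero: "(\<Sum>j\<in>UNIV - {i}. t $ j) = 0" and one: "t $ i = 1"
      using split rest_nn by auto
    have off: "t $ j = 0" if "j \<noteq> i" for j
      using zero nn that by (simp add: sum_nonneg_eq_0_iff)
    have "(\<chi> j. if j = i then 0 else x $ j) = 0"
      using off 2 by (simp add: vec_eq_iff)
    moreover have "x = axis i s"
      using off one 2 by (simp add: vec_eq_iff axis_def)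
    ultimately show ?thesis
      using 2 psi_norm_axis[OF assms(1), of s i] by (simp add: psi_norm_def)
  qed
qed

lemma psi_norm_mono_coord:
  fixes x y :: "real ^ 'n"
  assumes "\<psi> \<in> Psi" "0 \<le> x" "x $ i \<le> y $ i" and same: "\<And>j. j \<noteq> i \<Longrightarrow> x $ j = y $ j"
  shows "psi_norm \<psi> x \<le> psi_norm \<psi> y"
proof (cases "y $ i = 0")
  case True
  then have "x = y"
    using assms by (auto simp: vec_eq_iff less_eq_vec_def) (metis order_antisym)
  then show ?thesis by simp
next
  case False
  have xi: "0 \<le> x $ i"
    using assms by (simp add: less_eq_vec_def)
  have y: "0 \<le> y"
    using assms xi by (auto simp: less_eq_vec_def) (metis order_trans)
  \<comment> \<open>The weight that places \<open>x\<close> between \<open>y\<close> and the vector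
    \<open>z\<close> with coordinate \<open>i\<close> deleted.\<close>
  define l where "l = x $ i / y $ i"
  have l: "0 \<le> l" "l \<le> 1"
    using xi assms(3) by (auto simp: l_def divide_le_eq_1)
  define z where "z = (\<chi> j. if j = i then 0 else y $ j)"
  have z: "0 \<le> z"
    using y by (simp add: z_def less_eq_vec_def)
  have x_eq: "x = l *\<^sub>R y + (1 - l) *\<^sub>R z"
    using False same by (auto simp: vec_eq_iff l_def z_def algebra_simps)
  have "psi_norm \<psi> x \<le> psi_norm \<psi> (l *\<^sub>R y) + psi_norm \<psi> ((1 - l) *\<^sub>R z)"
    unfolding x_eq using Psi_convex[OF assms(1)] y z l
    by (intro psi_norm_add_le) (auto simp: less_eq_vec_def)
  also have "\<dots> = l * psi_norm \<psi> y + (1 - l) * psi_norm \<psi> z"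
    using y z l by (simp add: psi_norm_scaleR)
  also have "\<dots> \<le> l * psi_norm \<psi> y + (1 - l) * psi_norm \<psi> y"
    using psi_norm_delete_le[OF assms(1) y, of i] l
    by (intro add_left_mono mult_left_mono) (auto simp: z_def)
  finally show ?thesis
    by (simp add: algebra_simps)
qed

lemma psi_norm_mono:
  fixes x y :: "real ^ 'n"
  assumes "\<psi> \<in> Psi" "0 \<le> x" "x \<le> y"
  shows "psi_norm \<psi> x \<le> psi_norm \<psi> y"
proof -
  have le: "0 \<le> x $ j" "x $ j \<le> y $ j" for j
    using assms by (auto simp: less_eq_vec_def)
  \<comment> \<open>The coordinates are lowered one at a time; \<open>F\<close> collects those
    already lowered.\<close>
  have "psi_norm \<psi> (\<chi> j. if j \<in> F then x $ j else y $ j) \<le> psi_norm \<psi> y" for F :: "'n set"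
    using finite[of F]
  proof (induction F rule: finite_induct)
    case (insert i F)
    have "psi_norm \<psi> (\<chi> j. if j \<in> insert i F then x $ j else y $ j)
        \<le> psi_norm \<psi> (\<chi> j. if j \<in> F then x $ j else y $ j)"
      using insert.hyps le order_trans[OF le]
      by (intro psi_norm_mono_coord[OF assms(1), where i = i]) (auto simp: less_eq_vec_def)
    with insert.IH show ?case by simp
  qed simp
  from this[of UNIV] show ?thesis by simp
qed

text \<open>By monotonicity, deleting all other coordinates cannot increase the value, and it leaves
  an axis vector. This bound yields positivity and coercivity.\<close>

lemma component_le_psi_norm:
  assumes "\<psi> \<in> Psi"
  shows "norm (x $ i) \<le> psi_norm \<psi> x"
proof -
  have "norm (x $ i) = psi_norm \<psi> (axis i (norm (x $ i)))"
    using psi_norm_axis[OF assms] by simp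
  also have "\<dots> \<le> psi_norm \<psi> (\<chi> i. norm (x $ i))"
    by (intro psi_norm_mono[OF assms]) (auto simp: less_eq_vec_def axis_def)
  finally show ?thesis
    by (simp add: psi_norm_norm)
qed

lemma psi_norm_pos:
  assumes "\<psi> \<in> Psi" "x \<noteq> 0"
  shows "0 < psi_norm \<psi> x"
proof -
  obtain i where "x $ i \<noteq> 0"
    using assms(2) by (auto simp: vec_eq_iff)
  with component_le_psi_norm[OF assms(1), of x i] show ?thesis
    by (meson less_le_trans zero_less_norm_iff)
qed

lemma psi_norm_strict_mono:
  fixes x y :: "real ^ 'n"
  assumes "\<psi> \<in> Psi" "strictly_convex_on Omega \<psi>" "0 \<le> x" "x \<le> y" "x \<noteq> y"
  shows "psi_norm \<psi> x < psi_norm \<psi> y"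
proof -
  have le: "0 \<le> x $ j" "x $ j \<le> y $ j" for j
    using assms by (auto simp: less_eq_vec_def)
  have y: "0 \<le> y" "y \<noteq> 0"
    using assms by auto
  \<comment> \<open>Strict subadditivity does not cover \<open>x = 0\<close> or proportional
    vectors, so these are treated directly.\<close>
  consider "x = 0" | k where "0 < k" "x = k *\<^sub>R y" | "x \<noteq> 0" "\<And>k. 0 < k \<Longrightarrow> x \<noteq> k *\<^sub>R y"
    by blast
  then show ?thesis
  proof cases
    case 1
    then show ?thesis
      using psi_norm_pos[OF assms(1) y(2)] by (simp add: psi_norm_def)
  next
    case (2 k)
    \<comment> \<open>A differing coordinate forces \<open>k < 1\<close>; homogeneity and positivity
      then suffice.\<close>
    obtain j where j: "x $ j \<noteq> y $ j"
      using assms(5) by (auto simp: vec_eq_iff)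
    have "k * y $ j < 1 * y $ j" "0 \<le> y $ j"
      using le[of j] j 2 order_trans[OF le] by (auto simp: less_le)
    then have "k < 1"
      by (metis mult_right_mono not_less)
    then have "k * psi_norm \<psi> y < 1 * psi_norm \<psi> y"
      using psi_norm_pos[OF assms(1) y(2)] by (intro mult_strict_right_mono)
    then show ?thesis
      using 2 y by (simp add: psi_norm_scaleR)
  next
    case 3
    have mid: "2 * x $ j \<le> x $ j + y $ j" for j
      using le(2)[of j] by simp
    have "2 * psi_norm \<psi> x = psi_norm \<psi> (2 *\<^sub>R x)"
      using assms(3) by (simp add: psi_norm_scaleR)
    also have "psi_norm \<psi> (2 *\<^sub>R x) \<le> psi_norm \<psi> (x + y)"
      using le(1) mid by (intro psi_norm_mono[OF assms(1)]) (simp_all add: less_eq_vec_def)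
    also have "\<dots> < psi_norm \<psi> x + psi_norm \<psi> y"
      using 3 y assms by (intro psi_norm_add_less) auto
    finally show ?thesis by simp
  qed
qed

lemma psi_norm_const_vec:
  "psi_norm \<psi> (\<chi> i::'n::finite. u) = real CARD('n) * \<psi> (\<chi> i. 1 / real CARD('n)) * norm u"
proof (cases "u = 0")
  case True
  then have "(\<chi> i::'n. u) = 0"
    by (simp add: vec_eq_iff)
  with True show ?thesis
    by (simp add: psi_norm_def)
next
  case False
  then have "(\<chi> i::'n. u) \<noteq> 0"
    by (simp add: vec_eq_iff)
  with False show ?thesis
    by (simp add: psi_norm_def)
qed

section \<open>The objective function\<close>

text \<open>Moves the problem to the real orthant: \<open>f_psi\<close> depends on \<open>u\<close>
  and \<open>v\<close> only through these distances.\<close>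

definition dist_vec :: "'a::real_normed_vector ^ 'n \<Rightarrow> 'a \<Rightarrow> real ^ 'n" where
  "dist_vec v u = (\<chi> i. norm (u - v $ i))"

lemma dist_vec_nth [simp]: "dist_vec v u $ i = norm (u - v $ i)"
  by (simp add: dist_vec_def)

lemma dist_vec_nonneg: "0 \<le> dist_vec v u"
  by (simp add: less_eq_vec_def)

lemma dist_vec_nonzero:
  assumes "v $ i \<noteq> v $ j"
  shows "dist_vec v u \<noteq> 0"
  using assms by (auto simp: vec_eq_iff) metis

lemma f_psi_eq: "f_psi \<psi> v u = psi_norm \<psi> (dist_vec v u)"
  using psi_norm_norm[of \<psi> "\<chi> i. u - v $ i"] by (simp add: f_psi_def dist_vec_def)

section \<open>Convexity of the objective function\<close>

lemma norm_convex_comb_diff_le: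
  fixes x y w :: "'a::real_normed_vector"
  assumes "0 \<le> l" "l \<le> 1"
  shows "norm (l *\<^sub>R x + (1 - l) *\<^sub>R y - w) \<le> l * norm (x - w) + (1 - l) * norm (y - w)"
proof -
  have "l *\<^sub>R x + (1 - l) *\<^sub>R y - w = l *\<^sub>R (x - w) + (1 - l) *\<^sub>R (y - w)"
    by (simp add: algebra_simps)
  then show ?thesis
    using norm_triangle_ineq[of "l *\<^sub>R (x - w)" "(1 - l) *\<^sub>R (y - w)"] assms by simp
qed

lemma norm_convex_comb_diff_less:
  fixes x y w :: "'a::real_normed_vector"
  assumes "strictly_convex_norm (norm :: 'a \<Rightarrow> real)" "0 < l" "l < 1" "x \<noteq> w" "y \<noteq> w"
    and nonprop: "\<And>k. 0 < k \<Longrightarrow> x - w \<noteq> k *\<^sub>R (y - w)"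
  shows "norm (l *\<^sub>R x + (1 - l) *\<^sub>R y - w) < l * norm (x - w) + (1 - l) * norm (y - w)"
proof -
  \<comment> \<open>Rescaling preserves non-proportionality: a factor \<open>k\<close> here would be
    the factor \<open>k * (1 - l) / l\<close> between the original differences.\<close>
  have "l *\<^sub>R (x - w) \<noteq> k *\<^sub>R ((1 - l) *\<^sub>R (y - w))" if "0 < k" for k
  proof
    assume "l *\<^sub>R (x - w) = k *\<^sub>R ((1 - l) *\<^sub>R (y - w))"
    then have "(1 / l) *\<^sub>R (l *\<^sub>R (x - w)) = (1 / l) *\<^sub>R (k *\<^sub>R ((1 - l) *\<^sub>R (y - w)))"
      by simp
    then have "x - w = (k * (1 - l) / l) *\<^sub>R (y - w)"
      using assms(2) by simp
    moreover have "0 < k * (1 - l) / l"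
      using that assms(2,3) by simp
    ultimately show False
      using nonprop by blast
  qed
  then have "norm (l *\<^sub>R (x - w) + (1 - l) *\<^sub>R (y - w))
      < norm (l *\<^sub>R (x - w)) + norm ((1 - l) *\<^sub>R (y - w))"
    using assms by (simp add: strictly_convex_norm_def del: norm_scaleR scaleR_scaleR)
  moreover have "l *\<^sub>R x + (1 - l) *\<^sub>R y - w = l *\<^sub>R (x - w) + (1 - l) *\<^sub>R (y - w)"
    by (simp add: algebra_simps)
  ultimately show ?thesis
    using assms by simp
qed

lemma dist_vec_convex_comb_le:
  assumes "0 \<le> l" "l \<le> 1"
  shows "dist_vec v (l *\<^sub>R x + (1 - l) *\<^sub>R y) \<le> l *\<^sub>R dist_vec v x + (1 - l) *\<^sub>R dist_vec v y"
  by (simp add: less_eq_vec_def norm_convex_comb_diff_le[OF assms])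

lemma psi_norm_comb_le:
  fixes a b :: "real ^ 'n"
  assumes "\<psi> \<in> Psi" "0 \<le> a" "0 \<le> b" "0 \<le> l" "l \<le> 1"
  shows "psi_norm \<psi> (l *\<^sub>R a + (1 - l) *\<^sub>R b) \<le> l * psi_norm \<psi> a + (1 - l) * psi_norm \<psi> b"
  using psi_norm_add_le[OF Psi_convex[OF assms(1)], of "l *\<^sub>R a" "(1 - l) *\<^sub>R b"] assms
  by (simp add: psi_norm_scaleR less_eq_vec_def)

text \<open>Each coordinate of the distance vector is convex in \<open>u\<close>, and the extension
  is monotone and convex on the orthant.\<close>

lemma convex_on_f_psi:
  fixes v :: "'a::real_normed_vector ^ 'n"
  assumes "\<psi> \<in> Psi"
  shows "convex_on UNIV (f_psi \<psi> v)"
proof (rule convex_onI)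
  fix t :: real and x y :: 'a
  assume t: "0 < t" "t < 1"
  \<comment> \<open>\<open>convex_onI\<close> puts the weight \<open>t\<close> on \<open>y\<close>,
    so the combination lemmas apply with \<open>l = 1 - t\<close>.\<close>
  have "f_psi \<psi> v ((1 - t) *\<^sub>R x + (1 - (1 - t)) *\<^sub>R y)
      \<le> psi_norm \<psi> ((1 - t) *\<^sub>R dist_vec v x + (1 - (1 - t)) *\<^sub>R dist_vec v y)"
    unfolding f_psi_eq using t
    by (intro psi_norm_mono[OF assms] dist_vec_nonneg dist_vec_convex_comb_le) auto
  also have "\<dots> \<le> (1 - t) * f_psi \<psi> v x + (1 - (1 - t)) * f_psi \<psi> v y"
    unfolding f_psi_eq using t by (intro psi_norm_comb_le assms dist_vec_nonneg) auto
  finally show "f_psi \<psi> v ((1 - t) *\<^sub>R x + t *\<^sub>R y) \<le> (1 - t) * f_psi \<psi> v x + t * f_psi \<psi> v y"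
    by simp
qed simp

section \<open>Coercivity and Lipschitz continuity\<close>

lemma norm_diff_le_f_psi:
  assumes "\<psi> \<in> Psi"
  shows "norm (u - v $ i) \<le> f_psi \<psi> v u"
  using component_le_psi_norm[OF assms, of "dist_vec v u" i] by (simp add: f_psi_eq)

lemma filterlim_f_psi_at_infinity:
  assumes "\<psi> \<in> Psi"
  shows "filterlim (f_psi \<psi> v) at_top at_infinity"
proof (rule filterlim_at_top_mono)
  \<comment> \<open>The distance to any single \<open>v $ i\<close> already forces growth.\<close>
  fix i
  show "filterlim (\<lambda>u. norm u - norm (v $ i)) at_top at_infinity"
    using filterlim_tendsto_add_at_top[OF tendsto_const[of "- norm (v $ i)"]
        filterlim_norm_at_top]
    by simp
  show "\<forall>\<^sub>F u in at_infinity. norm u - norm (v $ i) \<le> f_psi \<psi> v u"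
    by (intro always_eventually allI order_trans[OF norm_triangle_ineq2 norm_diff_le_f_psi[OF assms]])
qed

text \<open>Moving \<open>u\<close> changes each distance by at most the length of the move, hence
  the distance vector by at most that multiple of the all-ones vector \<open>1\<close>; monotonicity
  and subadditivity turn this into the constant.\<close>

lemma lipschitz_on_f_psi:
  fixes v :: "'a::real_normed_vector ^ 'n"
  assumes "\<psi> \<in> Psi"
  shows "(psi_norm \<psi> (1 :: real ^ 'n))-lipschitz_on UNIV (f_psi \<psi> v)"
proof (rule lipschitz_onI)
  let ?L = "psi_norm \<psi> (1 :: real ^ 'n)"
  have one: "0 \<le> (1 :: real ^ 'n)"
    by (simp add: less_eq_vec_def)
  show "0 \<le> ?L"
    by (rule order_trans[OF norm_ge_zero component_le_psi_norm[OF assms]])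
  have le: "f_psi \<psi> v x \<le> f_psi \<psi> v y + ?L * dist x y" for x y
  proof -
    have "dist_vec v x \<le> dist_vec v y + dist x y *\<^sub>R 1"
      using norm_triangle_ineq[of "y - v $ _" "x - y"]
      by (simp add: less_eq_vec_def dist_norm)
    then have "f_psi \<psi> v x \<le> psi_norm \<psi> (dist_vec v y + dist x y *\<^sub>R 1)"
      unfolding f_psi_eq by (intro psi_norm_mono assms dist_vec_nonneg)
    also have "\<dots> \<le> psi_norm \<psi> (dist_vec v y) + psi_norm \<psi> (dist x y *\<^sub>R (1 :: real ^ 'n))"
      by (intro psi_norm_add_le Psi_convex assms dist_vec_nonneg) (simp add: less_eq_vec_def)
    finally show ?thesis
      using one by (simp add: psi_norm_scaleR f_psi_eq mult.commute)
  qed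
  show "dist (f_psi \<psi> v x) (f_psi \<psi> v y) \<le> ?L * dist x y" for x y
    using le[of x y] le[of y x] by (simp add: dist_real_def dist_commute abs_le_iff)
qed

section \<open>Strict convexity of the objective function\<close>

lemma strictly_convex_on_f_psi:
  fixes v :: "'a::real_normed_vector ^ 'n"
  assumes "\<psi> \<in> Psi" "strictly_convex_on Omega \<psi>"
    and norm: "strictly_convex_norm (norm :: 'a \<Rightarrow> real)" and v: "v $ p \<noteq> v $ q"
  shows "strictly_convex_on UNIV (f_psi \<psi> v)"
  unfolding strictly_convex_on_def
proof (intro conjI convex_on_f_psi assms ballI allI impI, elim conjE)
  fix x y :: 'a and l :: real
  assume "x \<noteq> y" and l: "0 < l" "l < 1"
  define a b c where "a = dist_vec v x" and "b = dist_vec v y"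
    and "c = dist_vec v (l *\<^sub>R x + (1 - l) *\<^sub>R y)"
  let ?d = "l *\<^sub>R a + (1 - l) *\<^sub>R b"
  have nonneg: "0 \<le> a" "0 \<le> b" "0 \<le> c"
    by (auto simp: a_def b_def c_def dist_vec_nonneg)
  have nonzero: "a \<noteq> 0" "b \<noteq> 0"
    using dist_vec_nonzero[OF v] by (auto simp: a_def b_def)
  have cd: "c \<le> ?d"
    unfolding a_def b_def c_def using l by (intro dist_vec_convex_comb_le) auto
  \<comment> \<open>Monotonicity leads from \<open>c\<close> to \<open>?d\<close>, and convexity of
    the extension from \<open>?d\<close> to the right-hand side. The second inequality is strict if
    \<open>a\<close> and \<open>b\<close> are not proportional; otherwise the first is.\<close>
  have "psi_norm \<psi> c < l * psi_norm \<psi> a + (1 - l) * psi_norm \<psi> b"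
  proof (cases "\<exists>k>0. a = k *\<^sub>R b")
    case False
    have "l *\<^sub>R a \<noteq> k *\<^sub>R ((1 - l) *\<^sub>R b)" if "0 < k" for k
    proof
      assume "l *\<^sub>R a = k *\<^sub>R ((1 - l) *\<^sub>R b)"
      then have "(1 / l) *\<^sub>R (l *\<^sub>R a) = (1 / l) *\<^sub>R (k *\<^sub>R ((1 - l) *\<^sub>R b))"
        by simp
      then have "a = (k * (1 - l) / l) *\<^sub>R b"
        using l by simp
      moreover have "0 < k * (1 - l) / l"
        using that l by simp
      ultimately show False
        using False by blast
    qed
    then have "psi_norm \<psi> ?d < psi_norm \<psi> (l *\<^sub>R a) + psi_norm \<psi> ((1 - l) *\<^sub>R b)"
      using assms nonneg nonzero l by (intro psi_norm_add_less) (auto simp: less_eq_vec_def)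
    with psi_norm_mono[OF assms(1) nonneg(3) cd] show ?thesis
      using nonneg l by (simp add: psi_norm_scaleR)
  next
    case True
    then obtain k where k: "0 < k" "a = k *\<^sub>R b"
      by blast
    have "c \<noteq> ?d"
    proof
      assume eq: "c = ?d"
      have eqs: "x - v $ i = k *\<^sub>R (y - v $ i)" for i
      proof -
        have nk: "norm (x - v $ i) = k * norm (y - v $ i)"
          using arg_cong[OF k(2), of "\<lambda>z. z $ i"] by (simp add: a_def b_def)
        have "norm (l *\<^sub>R x + (1 - l) *\<^sub>R y - v $ i)
            = l * norm (x - v $ i) + (1 - l) * norm (y - v $ i)"
          using arg_cong[OF eq, of "\<lambda>z. z $ i"] by (simp add: a_def b_def c_def)
        \<comment> \<open>Equality of norms leaves only these cases. Comparing lengths by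
          \<open>nk\<close> makes both differences zero in the first two; in the third it gives
          \<open>m = k\<close> unless they vanish.\<close>
        with norm_convex_comb_diff_less[OF norm l, of x "v $ i" y]
        consider "x = v $ i" | "y = v $ i" | m where "0 < m" "x - v $ i = m *\<^sub>R (y - v $ i)"
          by force
        then show ?thesis
        proof cases
          case (3 m)
          with nk k show ?thesis by auto
        qed (use nk k in auto)
      qed
      \<comment> \<open>Subtracting the equations for \<open>p\<close> and \<open>q\<close>
        eliminates \<open>x\<close> and \<open>y\<close>, and \<open>v $ p \<noteq> v $ q\<close>
        then forces \<open>k = 1\<close>.\<close>
      have "(x - v $ q) - (x - v $ p) = k *\<^sub>R (y - v $ q) - k *\<^sub>R (y - v $ p)"
        by (simp only: eqs)
      then have "v $ p - v $ q = k *\<^sub>R (v $ p - v $ q)"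
        by (simp flip: scaleR_diff_right)
      then have "(1 - k) *\<^sub>R (v $ p - v $ q) = 0"
        by (simp add: scaleR_diff_left)
      with v have "k = 1" by simp
      with eqs[of p] \<open>x \<noteq> y\<close> show False by simp
    qed
    then have "psi_norm \<psi> c < psi_norm \<psi> ?d"
      using psi_norm_strict_mono[OF assms(1,2) nonneg(3) cd] by simp
    also have "\<dots> \<le> l * psi_norm \<psi> a + (1 - l) * psi_norm \<psi> b"
      using l by (intro psi_norm_comb_le assms nonneg) auto
    finally show ?thesis .
  qed
  then show "f_psi \<psi> v (l *\<^sub>R x + (1 - l) *\<^sub>R y) < l * f_psi \<psi> v x + (1 - l) * f_psi \<psi> v y"
    by (simp add: f_psi_eq a_def b_def c_def)
qed

text \<open>The extension of the constant 1 is the l1 norm, so \<open>f_psi\<close> becomes the sum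
  of the distances to the \<open>v $ i\<close>.\<close>

lemma psi_norm_eq_sum:
  fixes x :: "real ^ 'n"
  assumes "\<forall>t\<in>Omega. \<psi> t = 1" "0 \<le> x"
  shows "psi_norm \<psi> x = (\<Sum>i\<in>UNIV. x $ i)"
  using assms(2)
proof (cases rule: nonneg_vec_cases)
  case (2 s t)
  then show ?thesis
    using assms(1) by (simp add: psi_norm_scaleR_Omega Omega_def flip: sum_distrib_left)
qed (simp add: psi_norm_def)

text \<open>In a sum of convex functions one strict inequality suffices; it comes from a point
  \<open>v $ i\<close> off the line through \<open>x\<close> and \<open>y\<close>.\<close>

lemma strictly_convex_on_f_psi_one:
  fixes v :: "'a::real_normed_vector ^ 'n"
  assumes "\<psi> \<in> Psi" and one: "\<forall>t\<in>Omega. \<psi> t = 1"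
    and norm: "strictly_convex_norm (norm :: 'a \<Rightarrow> real)"
    and ncol: "\<not> collinear (range (\<lambda>i. v $ i))"
  shows "strictly_convex_on UNIV (f_psi \<psi> v)"
  unfolding strictly_convex_on_def
proof (intro conjI convex_on_f_psi assms ballI allI impI, elim conjE)
  fix x y :: 'a and l :: real
  assume "x \<noteq> y" and l: "0 < l" "l < 1"
  obtain i where i: "\<And>s. v $ i \<noteq> y + s *\<^sub>R (x - y)"
  proof (rule ccontr)
    assume "\<not> thesis"
    with that obtain s where s: "\<And>i. v $ i = y + s i *\<^sub>R (x - y)"
      by metis
    have "v $ i - v $ j = (s i - s j) *\<^sub>R (x - y)" for i j
      by (simp add: s[of i] s[of j] algebra_simps)
    then have "collinear (range (\<lambda>i. v $ i))"
      unfolding collinear_def by blast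
    with ncol show False by blast
  qed
  have "norm (l *\<^sub>R x + (1 - l) *\<^sub>R y - v $ i) < l * norm (x - v $ i) + (1 - l) * norm (y - v $ i)"
  proof (rule norm_convex_comb_diff_less[OF norm l])
    show "x \<noteq> v $ i" using i[of 1] by simp
    show "y \<noteq> v $ i" using i[of 0] by simp
    \<comment> \<open>A factor \<open>k\<close> would place \<open>v $ i\<close> on that line at
      parameter \<open>1 / (1 - k)\<close>; \<open>k = 1\<close> is excluded by
      \<open>x \<noteq> y\<close>.\<close>
    fix k :: real assume "0 < k"
    show "x - v $ i \<noteq> k *\<^sub>R (y - v $ i)"
    proof
      assume eq: "x - v $ i = k *\<^sub>R (y - v $ i)"
      have "k \<noteq> 1" using eq \<open>x \<noteq> y\<close> by auto
      have "(1 - k) *\<^sub>R (v $ i - y) = x - y"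
        using eq by (simp add: algebra_simps)
      then have "(1 / (1 - k)) *\<^sub>R ((1 - k) *\<^sub>R (v $ i - y)) = (1 / (1 - k)) *\<^sub>R (x - y)"
        by simp
      then have "v $ i - y = (1 / (1 - k)) *\<^sub>R (x - y)"
        using \<open>k \<noteq> 1\<close> by simp
      then have "v $ i = y + (1 / (1 - k)) *\<^sub>R (x - y)"
        by (metis add.commute diff_add_cancel)
      with i show False by blast
    qed
  qed
  then have "(\<Sum>i\<in>UNIV. norm (l *\<^sub>R x + (1 - l) *\<^sub>R y - v $ i))
      < (\<Sum>i\<in>UNIV. l * norm (x - v $ i) + (1 - l) * norm (y - v $ i))"
    using l by (intro sum_strict_mono_ex1) (auto intro: norm_convex_comb_diff_le)
  then show "f_psi \<psi> v (l *\<^sub>R x + (1 - l) *\<^sub>R y) < l * f_psi \<psi> v x + (1 - l) * f_psi \<psi> v y"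
    by (simp add: f_psi_eq psi_norm_eq_sum[OF one] dist_vec_nonneg sum.distrib
        flip: sum_distrib_left)
qed

section \<open>Compactness of the set of minimizers\<close>

lemma compact_minimizers_f_psi:
  fixes v :: "'a::real_normed_vector ^ 'n"
  assumes "\<psi> \<in> Psi" "finite (B :: 'a set)" "span B = UNIV"
  shows "compact {u. \<forall>w. f_psi \<psi> v u \<le> f_psi \<psi> v w}" (is "compact ?M")
proof (rule finite_span_heine_borel[OF assms(2,3)])
  have "continuous_on UNIV (f_psi \<psi> v)"
    using lipschitz_on_f_psi[OF assms(1)] by (rule lipschitz_on_continuous_on)
  then show "closed ?M"
    by (intro closed_Collect_all closed_Collect_le continuous_on_const)
  fix i
  \<comment> \<open>The value at the arbitrary competitor \<open>0\<close> bounds the minimum, and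
    \<open>f_psi\<close> dominates the distance to \<open>v $ i\<close>.\<close>
  have "?M \<subseteq> cball (v $ i) (f_psi \<psi> v 0)"
    using order_trans[OF norm_diff_le_f_psi[OF assms(1), of _ v i]]
    by (auto simp: dist_norm norm_minus_commute)
  then show "bounded ?M"
    by (rule bounded_subset[OF bounded_cball])
qed

theorem proposition4p3:
  fixes v :: "'a::real_normed_vector ^ 'n"
    and \<psi> :: "real ^ 'n \<Rightarrow> real"
  assumes "CARD('n) \<ge> 2"
    and "inj (\<lambda>i. v $ i)"
    and "\<psi> \<in> Psi"
  shows "filterlim (f_psi \<psi> v) at_top at_infinity
    \<and> (\<forall>u::'a. psi_norm \<psi> (\<chi> i::'n. u)
          = real CARD('n) * \<psi> (\<chi> i. 1 / real CARD('n)) * norm u)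
    \<and> (strictly_convex_on Omega \<psi> \<and> strictly_convex_norm (norm :: 'a \<Rightarrow> real)
          \<longrightarrow> strictly_convex_on UNIV (f_psi \<psi> v))
    \<and> (strictly_convex_norm (norm :: 'a \<Rightarrow> real) \<and> \<not> collinear (range (\<lambda>i. v $ i))
          \<and> (\<forall>t\<in>Omega. \<psi> t = 1)
          \<longrightarrow> strictly_convex_on UNIV (f_psi \<psi> v))
    \<and> ((\<exists>B::'a set. finite B \<and> span B = UNIV)
          \<longrightarrow> compact {u. \<forall>w. f_psi \<psi> v u \<le> f_psi \<psi> v w})"
proof -
  \<comment> \<open>Two distinct indices give two distinct points by injectivity, which is how
    distinctness enters part (iii).\<close>
  have "\<not> is_singleton (UNIV :: 'n set)"
    using assms(1) by (simp add: is_singleton_altdef)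
  then obtain p q :: 'n where "p \<noteq> q"
    by (metis UNIV_eq_I is_singletonI singletonI)
  with assms(2) have "v $ p \<noteq> v $ q"
    by (auto dest: injD)
  with assms(3) show ?thesis
    by (intro conjI allI impI filterlim_f_psi_at_infinity psi_norm_const_vec)
      (auto intro: strictly_convex_on_f_psi strictly_convex_on_f_psi_one compact_minimizers_f_psi)
qed

end
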